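(* Let $m\ge 1$ and let $C=\{\mathbf{c}^{(1)},\mathbf{c}^{(2)},\ldots,\mathbf{c}^{(m)}\}$ be a set of nonempty compositions, $\mathbf{c}^{(i)}=(c^{(i)}_1,c^{(i)}_2,\ldots,c^{(i)}_{k_i})$, indexed so that $c^{(i)}_1\leq c^{(i+1)}_1$ for each $1\le i<m$. For $1\le j\le m$ let \[\hat{C}^j=\{\hat{\mathbf{c}}^{(1)},\hat{\mathbf{c}}^{(2)},\ldots,\hat{\mathbf{c}}^{(j)},\mathbf{c}^{(j+1)},\ldots,\mathbf{c}^{(m)}\}.\] Then for every $n\geq 1$, \[ b_n(C)=\sum_{i=1}^{c^{(1)}_1-1} b_{n-i}(C)+\sum_{i=c^{(1)}_1}^{c^{(2)}_1-1} b_{n-i}(\hat{C}^1)+\cdots+\sum_{i=c^{(m-1)}_1}^{c^{(m)}_1-1} b_{n-i}(\hat{C}^{m-1})+\sum_{i=c^{(m)}_1}^{n} b_{n-i}(\hat{C}^m), \] where $b_r(C')=0$ for all $r\geq 0$ if a set $C'$ of compositions contains the empty composition, and $b_0(C')=1$ for all nonempty sets $C'$ that do not contain the empty composition.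
   Context: A composition of $n\ge 1$ is a finite sequence $\mathbf{d}=(d_1,\ldots,d_m)$ of positive integers with $d_1+\cdots+d_m=n$. A composition $\mathbf{d}=(d_1,\ldots,d_m)$ contains a composition $\mathbf{c}=(c_1,\ldots,c_k)$ if there are indices $i_1<\cdots<i_k$ with $d_{i_j}\geq c_j$ for all $1\leq j\leq k$; otherwise $\mathbf{d}$ avoids $\mathbf{c}$. It avoids a set $C$ of compositions if it avoids every element of $C$. For a composition $\mathbf{c}=(c_1,\ldots,c_k)$ with $k\geq 1$, $\hat{\mathbf{c}}=(c_2,\ldots,c_k)$, which is the empty composition $()$ if $k=1$. For $n\ge1$, $b_n(C)$ is the number of compositions of $n$ that avoid all compositions in $C$. Conventions: no composition avoids the empty composition, so $b_r(C)=0$ for all $r\ge0$ if $()\in C$; $b_0(C)=1$ if $C$ is nonempty and $()\notin C$; $b_j(\cdot)=0$ for $j<0$; empty sums are $0$. *)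

theory Defs
  imports Main
begin

text \<open>
  A composition is a list of positive integers. The empty list is admitted as the empty
  composition, the only composition of \<open>0\<close>.
\<close>

definition is_composition :: "nat list \<Rightarrow> bool" where
  "is_composition d \<longleftrightarrow> (\<forall>x\<in>set d. 0 < x)"

definition contains :: "nat list \<Rightarrow> nat list \<Rightarrow> bool" where
  "contains d c \<longleftrightarrow>
     (\<exists>f :: nat \<Rightarrow> nat. strict_mono_on {..<length c} f \<and>
        (\<forall>j<length c. f j < length d \<and> d ! f j \<ge> c ! j))"

definition avoids :: "nat list \<Rightarrow> nat list set \<Rightarrow> bool" where
  "avoids d C \<longleftrightarrow> (\<forall>c\<in>C. \<not> contains d c)"

text \<open>
  The index of \<open>b\<close> is an integer because the recurrence also refers to negative indices.
  The conventions for \<open>b\<close> at non-positive indices, and for sets containing the empty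
  composition, are consequences of this definition; see the three lemmas below.
\<close>

definition b :: "int \<Rightarrow> nat list set \<Rightarrow> nat" where
  "b n C = card {d. is_composition d \<and> int (sum_list d) = n \<and> avoids d C}"

lemma b_neg: "n < 0 \<Longrightarrow> b n C = 0"
proof -
  assume "n < 0"
  then have "{d. is_composition d \<and> int (sum_list d) = n \<and> avoids d C} = {}" by auto
  then show ?thesis unfolding b_def by (simp only: card.empty)
qed

lemma b_Nil: "[] \<in> C \<Longrightarrow> b n C = 0"
proof -
  assume "[] \<in> C"
  then have "\<not> avoids d C" for d
    by (auto simp: avoids_def contains_def strict_mono_on_def intro!: bexI[of _ "[]"])
  then show ?thesis by (simp add: b_def)
qed

lemma b_0: "[] \<notin> C \<Longrightarrow> b 0 C = 1"
proof -
  assume *: "[] \<notin> C"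
  have "avoids [] C"
    using * by (fastforce simp: avoids_def contains_def)
  moreover have "d = []" if "is_composition d" "sum_list d = 0" for d
    using that by (cases d) (auto simp: is_composition_def)
  ultimately have "{d. is_composition d \<and> int (sum_list d) = 0 \<and> avoids d C} = {[]}"
    by (auto simp: is_composition_def)
  then show ?thesis by (simp only: b_def card.insert card.empty finite.emptyI) simp
qed

text \<open>
  The set written with a hat over \<open>C\<close> and superscript \<open>j\<close>, for the family \<open>c 1, \<dots>, c m\<close>: the first part is deleted from
  each of \<open>c 1, \<dots>, c j\<close>.
\<close>

definition hat_set :: "(nat \<Rightarrow> nat list) \<Rightarrow> nat \<Rightarrow> nat \<Rightarrow> nat list set" where
  "hat_set c m j = {tl (c i) | i. 1 \<le> i \<and> i \<le> j} \<union> {c i | i. j < i \<and> i \<le> m}"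

end

theory Submission
  imports Defs
begin

text \<open>
  Matching a pattern into a composition can be done greedily: if the first part \<open>x\<close> of
  \<open>x # d\<close> is at least the first part of \<open>c\<close>, it may as well be used for it, and otherwise \<open>x\<close>
  cannot be used for any part of \<open>c\<close> at all, since the parts of \<open>c\<close> have to be matched from left to
  right (\<open>contains_Cons_Cons\<close>). So \<open>x # d\<close> avoids \<open>C\<close> exactly if \<open>d\<close> avoids the set \<open>residual x C\<close>,
  in which the first part is deleted from the patterns whose first part is at most \<open>x\<close>. Classifying
  the compositions of \<open>n\<close> by their first part gives the uniform recurrence \<open>b_rec_residual\<close>,
  where the \<open>x\<close>-th term is \<open>b (n - x) (residual x C)\<close>.

  Since the patterns are sorted by their first parts, the patterns truncated by \<open>x\<close> form an initial
  segment of the family, and \<open>residual x C\<close> is the set \<open>hat_set c m j\<close>, where \<open>j\<close> is the number of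
  patterns with first part at most \<open>x\<close>. This \<open>j\<close> is constant on each of the intervals into which the
  first parts cut the range of \<open>x\<close>, and cutting the sum there gives the claim. The cut points may
  exceed \<open>n\<close>, which is harmless since \<open>b\<close> vanishes at negative indices.
\<close>

section \<open>Greedy matching\<close>

text \<open>
  Dropping the first part of the composition shifts all positions of an embedding by one. This is
  possible unless the embedding uses position \<open>0\<close>, and by monotonicity only the first part of the
  pattern can sit there.
\<close>

lemma contains_Cons_Cons:
  "contains (x # d) (y # c) \<longleftrightarrow> (if y \<le> x then contains d c else contains d (y # c))"
proof
  assume "contains (x # d) (y # c)"
  then obtain f where mono: "strict_mono_on {..<Suc (length c)} f"
    and f: "\<And>j. j < Suc (length c) \<Longrightarrow> f j < Suc (length d) \<and> (y # c) ! j \<le> (x # d) ! f j"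
    by (auto simp: contains_def)
  have step: "f i < f j" if "i < j" "j < Suc (length c)" for i j
    using mono that by (auto simp: strict_mono_on_def)
  show "if y \<le> x then contains d c else contains d (y # c)"
  proof (cases "y \<le> x")
    case True
    have pos: "0 < f (Suc j)" if "j < length c" for j
      using step[of 0 "Suc j"] that by simp
    have "f (Suc i) - 1 < f (Suc j) - 1" if "i < j" "j < length c" for i j
      using step[of "Suc i" "Suc j"] pos[of i] that by simp
    then have "strict_mono_on {..<length c} (\<lambda>j. f (Suc j) - 1)"
      by (auto simp: strict_mono_on_def)
    moreover have "f (Suc j) - 1 < length d \<and> c ! j \<le> d ! (f (Suc j) - 1)"
      if "j < length c" for j
      using f[of "Suc j"] pos[of j] that by (auto simp: nth_Cons')
    ultimately show ?thesis
      using True by (auto simp: contains_def intro!: exI[of _ "\<lambda>j. f (Suc j) - 1"])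
  next
    case False
    have "0 < f 0"
      using f[of 0] False by (cases "f 0") auto
    then have pos: "0 < f j" if "j < Suc (length c)" for j
      using step[of 0 j] that by (cases j) auto
    have "f i - 1 < f j - 1" if "i < j" "j < Suc (length c)" for i j
      using step[of i j] pos[of i] that by simp
    then have "strict_mono_on {..<Suc (length c)} (\<lambda>j. f j - 1)"
      by (auto simp: strict_mono_on_def)
    moreover have "f j - 1 < length d \<and> (y # c) ! j \<le> d ! (f j - 1)"
      if "j < Suc (length c)" for j
      using f[of j] pos[of j] that by (auto simp: nth_Cons')
    ultimately show ?thesis
      using False by (auto simp: contains_def intro!: exI[of _ "\<lambda>j. f j - 1"])
  qed
next
  assume *: "if y \<le> x then contains d c else contains d (y # c)"
  show "contains (x # d) (y # c)"
  proof (cases "y \<le> x")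
    case True
    with * obtain f where mono: "strict_mono_on {..<length c} f"
      and f: "\<And>j. j < length c \<Longrightarrow> f j < length d \<and> c ! j \<le> d ! f j"
      by (auto simp: contains_def)
    let ?g = "\<lambda>j. case j of 0 \<Rightarrow> 0 | Suc k \<Rightarrow> Suc (f k)"
    have "strict_mono_on {..<Suc (length c)} ?g"
      using mono by (auto simp: strict_mono_on_def split: nat.split)
    moreover have "?g j < Suc (length d) \<and> (y # c) ! j \<le> (x # d) ! ?g j"
      if "j < Suc (length c)" for j
      using f True that by (auto split: nat.split)
    ultimately show ?thesis
      by (auto simp: contains_def intro!: exI[of _ ?g])
  next
    case False
    with * obtain f where "strict_mono_on {..<Suc (length c)} f"
      and "\<And>j. j < Suc (length c) \<Longrightarrow> f j < length d \<and> (y # c) ! j \<le> d ! f j"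
      by (auto simp: contains_def)
    then show ?thesis
      by (auto simp: contains_def strict_mono_on_def intro!: exI[of _ "\<lambda>j. Suc (f j)"])
  qed
qed

section \<open>Splitting off the first part\<close>

definition residual :: "nat \<Rightarrow> nat list set \<Rightarrow> nat list set" where
  "residual x C = (\<lambda>c. if hd c \<le> x then tl c else c) ` C"

lemma avoids_Cons:
  assumes "[] \<notin> C"
  shows "avoids (x # d) C \<longleftrightarrow> avoids d (residual x C)"
proof -
  have "contains (x # d) c \<longleftrightarrow> contains d (if hd c \<le> x then tl c else c)" if "c \<in> C" for c
    using assms that by (cases c) (auto simp: contains_Cons_Cons)
  then show ?thesis
    unfolding avoids_def residual_def ball_simps by (intro ball_cong) simp_all
qed

lemma finite_compositions: "finite {d. is_composition d \<and> sum_list d = n}"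
proof (rule finite_subset)
  show "{d. is_composition d \<and> sum_list d = n} \<subseteq> {d. set d \<subseteq> {..n} \<and> length d \<le> n}"
  proof clarify
    fix d :: "nat list"
    assume "is_composition d"
    then have "length d \<le> sum_list d"
      by (induction d) (auto simp: is_composition_def)
    then show "set d \<subseteq> {..sum_list d} \<and> length d \<le> sum_list d"
      by (auto intro: member_le_sum_list)
  qed
  show "finite {d. set d \<subseteq> {..n} \<and> length d \<le> n}"
    by (rule finite_lists_length_le) simp
qed

lemma b_rec_residual:
  assumes "[] \<notin> C" and "n \<ge> 1"
  shows "b (int n) C = (\<Sum>x\<in>{1..n}. b (int n - int x) (residual x C))"
proof -
  define B where "B k D = {d. is_composition d \<and> sum_list d = k \<and> avoids d D}" for k D
  have b_B: "b (int k) D = card (B k D)" for k D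
    by (simp add: b_def B_def)
  have fin: "finite (B k D)" for k D
    by (rule finite_subset[OF _ finite_compositions[of k]]) (auto simp: B_def)
  have "B n C = (\<Union>x\<in>{1..n}. (#) x ` B (n - x) (residual x C))"
  proof (intro set_eqI iffI)
    fix d assume "d \<in> B n C"
    moreover from this \<open>n \<ge> 1\<close> obtain x e where "d = x # e"
      by (cases d) (auto simp: B_def)
    ultimately have "x \<in> {1..n}" and "e \<in> B (n - x) (residual x C)"
      using assms(1) by (auto simp: B_def is_composition_def avoids_Cons)
    with \<open>d = x # e\<close> show "d \<in> (\<Union>x\<in>{1..n}. (#) x ` B (n - x) (residual x C))"
      by blast
  next
    fix d assume "d \<in> (\<Union>x\<in>{1..n}. (#) x ` B (n - x) (residual x C))"
    with assms show "d \<in> B n C"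
      by (auto simp: B_def is_composition_def avoids_Cons)
  qed
  then have "b (int n) C = (\<Sum>x\<in>{1..n}. card ((#) x ` B (n - x) (residual x C)))"
    unfolding b_B by (simp only:) (rule card_UN_disjoint, use fin in auto)
  also have "\<dots> = (\<Sum>x\<in>{1..n}. b (int n - int x) (residual x C))"
    by (intro sum.cong refl) (simp add: card_image b_B flip: of_nat_diff)
  finally show ?thesis .
qed

section \<open>Cutting the sum at the first parts\<close>

lemma residual_eq_hat_set:
  assumes C: "C = {c i | i. 1 \<le> i \<and> i \<le> m}" and "j \<le> m"
    and le: "\<And>i. 1 \<le> i \<Longrightarrow> i \<le> j \<Longrightarrow> hd (c i) \<le> x"
    and gt: "\<And>i. j < i \<Longrightarrow> i \<le> m \<Longrightarrow> x < hd (c i)"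
  shows "residual x C = hat_set c m j"
proof -
  have split: "{1..m} = {1..j} \<union> {j<..m}"
    using \<open>j \<le> m\<close> by auto
  have "C = c ` {1..m}"
    by (auto simp: C)
  then have "residual x C = (\<lambda>i. if hd (c i) \<le> x then tl (c i) else c i) ` {1..m}"
    by (simp only: residual_def image_image)
  also have "\<dots> = (\<lambda>i. tl (c i)) ` {1..j} \<union> c ` {j<..m}"
    unfolding split image_Un using le gt
    by (intro arg_cong2[of _ _ _ _ "(\<union>)"] image_cong refl) (auto simp flip: not_less)
  also have "\<dots> = hat_set c m j"
    by (auto simp: hat_set_def)
  finally show ?thesis .
qed

lemma sum_cut_at_mono:
  fixes h :: "nat \<Rightarrow> nat" and F :: "nat \<Rightarrow> 'a::comm_monoid_add"
  assumes "m \<ge> 1" and "a \<le> h 1" and "\<And>i. 1 \<le> i \<Longrightarrow> i < m \<Longrightarrow> h i \<le> h (Suc i)"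
  shows "sum F {a..<h 1} + (\<Sum>j\<in>{1..<m}. sum F {h j..<h (Suc j)}) = sum F {a..<h m}
           \<and> a \<le> h m"
  using assms
proof (induction m rule: nat_induct_at_least)
  case base
  then show ?case by simp
next
  case (Suc m)
  then have "sum F {a..<h 1} + (\<Sum>j\<in>{1..<m}. sum F {h j..<h (Suc j)}) = sum F {a..<h m}"
    and "a \<le> h m" and "h m \<le> h (Suc m)"
    by auto
  then show ?case
    using Suc.hyps by (simp add: sum.atLeastLessThan_concat flip: add.assoc)
qed

theorem theorem2p4:
  fixes c :: "nat \<Rightarrow> nat list" and m n :: nat and C :: "nat list set"
  assumes "m \<ge> 1"
    and "C = {c i | i. 1 \<le> i \<and> i \<le> m}"
    and "\<And>i. 1 \<le> i \<Longrightarrow> i \<le> m \<Longrightarrow> is_composition (c i) \<and> c i \<noteq> []"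
    and "\<And>i. 1 \<le> i \<Longrightarrow> i < m \<Longrightarrow> hd (c i) \<le> hd (c (i + 1))"
    and "n \<ge> 1"
  shows "b (int n) C =
           (\<Sum>i\<in>{1..<hd (c 1)}. b (int n - int i) C)
         + (\<Sum>j\<in>{1..<m}. \<Sum>i\<in>{hd (c j)..<hd (c (j + 1))}. b (int n - int i) (hat_set c m j))
         + (\<Sum>i\<in>{hd (c m)..n}. b (int n - int i) (hat_set c m m))"
proof -
  define h where "h i = hd (c i)" for i
  define F where "F x = b (int n - int x) (residual x C)" for x
  have mono: "h i \<le> h j" if "1 \<le> i" "i \<le> j" "j \<le> m" for i j
    using that(2,1,3)
  proof (induction j rule: dec_induct)
    case (step k)
    then show ?case using assms(4)[of k] by (simp add: h_def)
  qed simp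
  have h1: "1 \<le> h 1"
    using assms(1) assms(3)[of 1] by (cases "c 1") (auto simp: h_def is_composition_def)
  have "[] \<notin> C"
    using assms(3) unfolding assms(2) by fastforce

  have F_less: "F x = b (int n - int x) C" if "x < h 1" for x
  proof -
    have "residual x C = hat_set c m 0"
    proof (rule residual_eq_hat_set[OF assms(2)])
      fix i assume "0 < i" "i \<le> m"
      then show "x < hd (c i)" using mono[of 1 i] that by (simp add: h_def)
    qed auto
    also have "\<dots> = C"
      by (auto simp: hat_set_def assms(2) Suc_le_eq)
    finally show ?thesis by (simp add: F_def)
  qed
  have F_between: "F x = b (int n - int x) (hat_set c m j)"
    if "1 \<le> j" "j < m" "h j \<le> x" "x < h (Suc j)" for x j
  proof -
    have "residual x C = hat_set c m j"
    proof (rule residual_eq_hat_set[OF assms(2)])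
      fix i assume "1 \<le> i" "i \<le> j"
      then show "hd (c i) \<le> x" using mono[of i j] that by (simp add: h_def)
    next
      fix i assume "j < i" "i \<le> m"
      then show "x < hd (c i)" using mono[of "Suc j" i] that by (simp add: h_def)
    qed (use that in simp)
    then show ?thesis by (simp add: F_def)
  qed
  have F_ge: "F x = b (int n - int x) (hat_set c m m)" if "h m \<le> x" for x
  proof -
    have "residual x C = hat_set c m m"
    proof (rule residual_eq_hat_set[OF assms(2)])
      fix i assume "1 \<le> i" "i \<le> m"
      then show "hd (c i) \<le> x" using mono[of i m] that by (simp add: h_def)
    qed auto
    then show ?thesis by (simp add: F_def)
  qed

  have cut: "sum F {1..<h 1} + (\<Sum>j\<in>{1..<m}. sum F {h j..<h (Suc j)}) = sum F {1..<h m}"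
    and hm: "1 \<le> h m"
    using sum_cut_at_mono[of m 1 h F] assms(1) h1 mono by auto
  have "b (int n) C = sum F {1..n}"
    unfolding F_def by (rule b_rec_residual[OF \<open>[] \<notin> C\<close> assms(5)])
  \<comment> \<open>If \<open>h m > n + 1\<close>, the first sum overshoots \<open>n\<close>, but only by terms that are \<open>0\<close>.\<close>
  also have "\<dots> = sum F {1..<h m} + sum F {h m..n}"
  proof (cases "h m \<le> Suc n")
    case True
    then show ?thesis
      using hm by (simp add: sum.atLeastLessThan_concat flip: atLeastLessThanSuc_atLeastAtMost
          del: sum.op_ivl_Suc)
  next
    case False
    then have "sum F {1..n} = sum F {1..<h m}"
      by (intro sum.mono_neutral_left) (auto simp: F_def b_neg)
    with False show ?thesis by simp
  qed
  also have "sum F {1..<h m} = sum F {1..<h 1} + (\<Sum>j\<in>{1..<m}. sum F {h j..<h (Suc j)})"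
    by (rule cut[symmetric])
  also have "sum F {1..<h 1} = (\<Sum>i\<in>{1..<h 1}. b (int n - int i) C)"
    by (intro sum.cong refl) (simp add: F_less)
  also have "(\<Sum>j\<in>{1..<m}. sum F {h j..<h (Suc j)})
      = (\<Sum>j\<in>{1..<m}. \<Sum>i\<in>{h j..<h (Suc j)}. b (int n - int i) (hat_set c m j))"
    by (intro sum.cong refl) (simp add: F_between)
  also have "sum F {h m..n} = (\<Sum>i\<in>{h m..n}. b (int n - int i) (hat_set c m m))"
    by (intro sum.cong refl) (simp add: F_ge)
  finally show ?thesis
    by (simp add: h_def)
qed

end
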